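(* Let $G=(V,E)$ be a finite simple graph and let $g\in\{0,1,-1\}^E$ be a mixed-sign vector. If $\mathrm{supp}(g)$ is the edge set of an alternating path in $G$, or the edge set of an even length alternating cycle of length at least $4$ in $G$, then $g$ is a circuit of the rank inequality system of $G$.
   Context: A vector is mixed-sign if it has at least one positive and at least one negative entry. A path or (even length) cycle with edge set $\mathrm{supp}(g)$ is alternating if any two consecutive edges $e,f$ along it satisfy $g(e)=-g(f)$. The rank inequality system of $G$ is $\sum_{e\in E(G[U])}x(e)\le |U|-1$ for all $\emptyset\neq U\subseteq V$, where $G[U]$ is the subgraph induced by $U$; let $B$ be its constraint matrix, so $(Bx)_U=\sum_{e\in E(G[U])}x(e)$. A circuit of the system is a vector $g\in\mathbb{R}^E\setminus\{0\}$ with coprime integer components such that the support of $Bg$ is inclusion-minimal among the supports of $\{Bx : x\in\mathbb{R}^E\setminus\{0\}\}$. *)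

theory Defs
  imports Complex_Main
begin

definition finite_simple_graph :: "'a set \<Rightarrow> 'a set set \<Rightarrow> bool" where
  "finite_simple_graph V E \<longleftrightarrow> finite V \<and> (\<forall>e\<in>E. e \<subseteq> V \<and> card e = 2)"

definition induced_edges :: "'a set set \<Rightarrow> 'a set \<Rightarrow> 'a set set" where
  "induced_edges E U = {e \<in> E. e \<subseteq> U}"

(* The space R^E: a vector indexed by E is a function that vanishes outside E,
   so that equality of vectors is equality of functions. *)
definition edge_space :: "'a set set \<Rightarrow> ('a set \<Rightarrow> real) set" where
  "edge_space E = {x. \<forall>e. e \<notin> E \<longrightarrow> x e = 0}"

definition supp :: "('b \<Rightarrow> real) \<Rightarrow> 'b set" where
  "supp x = {i. x i \<noteq> 0}"

definition mixed_sign :: "('b \<Rightarrow> real) \<Rightarrow> bool" where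
  "mixed_sign x \<longleftrightarrow> (\<exists>i. x i > 0) \<and> (\<exists>i. x i < 0)"

(* Paths and cycles are given by their lists of distinct vertices. The first
   vertex of a cycle is not repeated at the end of the list, so the list length
   is the length of the cycle. *)
definition path_edges :: "'a list \<Rightarrow> 'a set list" where
  "path_edges vs = map2 (\<lambda>u v. {u, v}) vs (tl vs)"

definition cycle_edges :: "'a list \<Rightarrow> 'a set list" where
  "cycle_edges vs = path_edges (vs @ [hd vs])"

definition is_path :: "'a set \<Rightarrow> 'a set set \<Rightarrow> 'a list \<Rightarrow> bool" where
  "is_path V E vs \<longleftrightarrow>
     vs \<noteq> [] \<and> distinct vs \<and> set vs \<subseteq> V \<and> set (path_edges vs) \<subseteq> E"

definition is_cycle :: "'a set \<Rightarrow> 'a set set \<Rightarrow> 'a list \<Rightarrow> bool" where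
  "is_cycle V E vs \<longleftrightarrow>
     3 \<le> length vs \<and> distinct vs \<and> set vs \<subseteq> V \<and> set (cycle_edges vs) \<subseteq> E"

definition alternating_path :: "('a set \<Rightarrow> real) \<Rightarrow> 'a list \<Rightarrow> bool" where
  "alternating_path g vs \<longleftrightarrow> successively (\<lambda>e f. g e = - g f) (path_edges vs)"

(* The first edge is appended because it is consecutive to the last one. *)
definition alternating_cycle :: "('a set \<Rightarrow> real) \<Rightarrow> 'a list \<Rightarrow> bool" where
  "alternating_cycle g vs \<longleftrightarrow>
     successively (\<lambda>e f. g e = - g f) (cycle_edges vs @ [hd (cycle_edges vs)])"

(* The vector B x, where B is the constraint matrix of the rank inequality system
     x(E(G[U])) \<le> card U - 1   for all nonempty U \<subseteq> V.
   Its rows are indexed by the nonempty subsets of V; as in edge_space, the vector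
   is extended by zero to all other index sets. *)
definition rank_matrix_mult ::
    "'a set \<Rightarrow> 'a set set \<Rightarrow> ('a set \<Rightarrow> real) \<Rightarrow> 'a set \<Rightarrow> real" where
  "rank_matrix_mult V E x U =
     (if U \<subseteq> V \<and> U \<noteq> {} then \<Sum>e\<in>induced_edges E U. x e else 0)"

definition coprime_integral :: "'b set \<Rightarrow> ('b \<Rightarrow> real) \<Rightarrow> bool" where
  "coprime_integral I x \<longleftrightarrow>
     (\<exists>z :: 'b \<Rightarrow> int. (\<forall>i\<in>I. x i = of_int (z i)) \<and> Gcd (z ` I) = 1)"

definition rank_circuit :: "'a set \<Rightarrow> 'a set set \<Rightarrow> ('a set \<Rightarrow> real) \<Rightarrow> bool" where
  "rank_circuit V E g \<longleftrightarrow>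
     g \<in> edge_space E \<and> g \<noteq> (\<lambda>_. 0) \<and> coprime_integral E g \<and>
     (\<forall>x\<in>edge_space E. x \<noteq> (\<lambda>_. 0) \<longrightarrow>
        \<not> supp (rank_matrix_mult V E x) \<subset> supp (rank_matrix_mult V E g))"

end

theory Submission
  imports Defs
begin

text \<open>
  The support of \<open>B x\<close> is contained in that of \<open>B g\<close> exactly when every vertex set \<open>U\<close> whose induced
  edges have \<open>g\<close>-sum zero also has \<open>x\<close>-sum zero. Vertex sets with two or three elements already
  force any such \<open>x\<close> to be a scalar multiple of \<open>g\<close>:

  \<^item> If \<open>g\<close> vanishes on an edge \<open>e\<close>, then \<open>U = e\<close> has sum zero, so \<open>x\<close> vanishes on \<open>e\<close>. Thus
    \<open>supp x \<subseteq> supp g\<close> (lemma \<open>vanishes_off_supp\<close>).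

  \<^item> Let \<open>{u, v}\<close> and \<open>{v, w}\<close> be consecutive edges of the path or cycle. The only further
    edge that \<open>U = {u, v, w}\<close> can induce is the chord \<open>{u, w}\<close>. It is not an edge of the path,
    nor of the cycle when the length is at least four, so \<open>g\<close> vanishes on it. As the values of \<open>g\<close> on
    the two edges cancel, \<open>U\<close> has sum zero, and hence the values of \<open>x\<close> on the two edges cancel too
    (lemma \<open>alternates_without_chord\<close>).

  So \<open>x\<close> alternates along the path or cycle just as \<open>g\<close> does, which fixes \<open>x\<close> up to a factor. If
  \<open>x \<noteq> 0\<close>, the factor is nonzero and \<open>B x\<close> and \<open>B g\<close> have the same support, so no support is strictly
  smaller. A cycle is treated as the closed walk that returns to its first vertex. Coprimality holds
  because \<open>g\<close> has a positive entry, which is \<open>1\<close>.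
\<close>

lemma coprime_integral_if_one:
  assumes "\<forall>i\<in>I. x i \<in> \<int>" and "i \<in> I" and "x i = 1"
  shows "coprime_integral I x"
  unfolding coprime_integral_def
proof (intro exI conjI ballI)
  show "x j = of_int \<lfloor>x j\<rfloor>" if "j \<in> I" for j
    using assms(1) that by (metis Ints_cases floor_of_int)
  have "1 \<in> (\<lambda>j. \<lfloor>x j\<rfloor>) ` I"
    using assms(2,3) by (intro image_eqI[of _ _ i]) simp_all
  then show "Gcd ((\<lambda>j. \<lfloor>x j\<rfloor>) ` I) = 1"
    by (metis Gcd_dvd Gcd_int_greater_eq_0 abs_of_nonneg zdvd1_eq)
qed

text \<open>
  A nonzero multiple of \<open>g\<close> has an image under \<open>B\<close> with the same support as \<open>B g\<close>, never a strictly
  smaller one.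
\<close>

lemma rank_circuitI:
  assumes "g \<in> edge_space E" and "g \<noteq> (\<lambda>_. 0)" and "coprime_integral E g"
    and multiple: "\<And>x. x \<in> edge_space E \<Longrightarrow>
      supp (rank_matrix_mult V E x) \<subseteq> supp (rank_matrix_mult V E g) \<Longrightarrow> \<exists>c. \<forall>e. x e = c * g e"
  shows "rank_circuit V E g"
proof -
  have "\<not> supp (rank_matrix_mult V E x) \<subset> supp (rank_matrix_mult V E g)"
    if x: "x \<in> edge_space E" "x \<noteq> (\<lambda>_. 0)" for x
  proof
    assume less: "supp (rank_matrix_mult V E x) \<subset> supp (rank_matrix_mult V E g)"
    then obtain c where c: "\<And>e. x e = c * g e"
      using multiple x(1) by blast
    with x(2) have "c \<noteq> 0" by auto
    moreover have "rank_matrix_mult V E x U = c * rank_matrix_mult V E g U" for U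
      by (simp add: rank_matrix_mult_def c sum_distrib_left)
    ultimately have "supp (rank_matrix_mult V E x) = supp (rank_matrix_mult V E g)"
      by (simp add: supp_def)
    with less show False by simp
  qed
  with assms(1-3) show ?thesis
    by (simp add: rank_circuit_def)
qed

lemma rank_matrix_mult_edge:
  assumes "finite_simple_graph V E" and "e \<in> E"
  shows "rank_matrix_mult V E x e = x e"
proof -
  have e: "e \<subseteq> V" "card e = 2" and two: "\<And>f. f \<in> E \<Longrightarrow> card f = 2"
    using assms by (auto simp: finite_simple_graph_def)
  then have "finite e" by (metis card.infinite zero_neq_numeral)
  then have "induced_edges E e = {e}"
    unfolding induced_edges_def using assms(2) e(2) two card_subset_eq[of e] by auto
  with e show ?thesis by (auto simp: rank_matrix_mult_def)
qed

text \<open>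
  Vectors of the edge space vanish on pairs that are not edges, so the formula does not depend on
  which of the three pairs are edges.
\<close>

lemma rank_matrix_mult_triple:
  assumes "finite_simple_graph V E" and "x \<in> edge_space E"
    and "{u, v, w} \<subseteq> V" and "distinct [u, v, w]"
  shows "rank_matrix_mult V E x {u, v, w} = x {u, v} + x {v, w} + x {u, w}"
proof -
  have sub: "induced_edges E {u, v, w} \<subseteq> {{u, v}, {v, w}, {u, w}}"
  proof
    fix e assume "e \<in> induced_edges E {u, v, w}"
    then have "e \<subseteq> {u, v, w}" "card e = 2"
      using assms(1) by (auto simp: induced_edges_def finite_simple_graph_def)
    moreover from this obtain a b where "e = {a, b}" "a \<noteq> b"
      by (auto simp: card_2_iff)
    ultimately show "e \<in> {{u, v}, {v, w}, {u, w}}" by auto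
  qed
  have "(\<Sum>e\<in>induced_edges E {u, v, w}. x e) = (\<Sum>e\<in>{{u, v}, {v, w}, {u, w}}. x e)"
    using sub assms(2) by (intro sum.mono_neutral_left) (auto simp: induced_edges_def edge_space_def)
  also have "\<dots> = x {u, v} + x {v, w} + x {u, w}"
    using assms(4) by (subst sum.insert; auto simp: doubleton_eq_iff)+
  finally show ?thesis using assms(3) by (simp add: rank_matrix_mult_def)
qed

lemma vanishes_off_supp:
  assumes "finite_simple_graph V E" and "x \<in> edge_space E"
    and sub: "supp (rank_matrix_mult V E x) \<subseteq> supp (rank_matrix_mult V E g)"
    and "g e = 0"
  shows "x e = 0"
proof (cases "e \<in> E")
  case True
  then show ?thesis
    using rank_matrix_mult_edge[OF assms(1) True] sub assms(4) unfolding supp_def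
    by (metis (mono_tags) mem_Collect_eq subsetD)
next
  case False
  with assms(2) show ?thesis by (simp add: edge_space_def)
qed

lemma alternates_without_chord:
  assumes G: "finite_simple_graph V E" and g: "g \<in> edge_space E" and x: "x \<in> edge_space E"
    and sub: "supp (rank_matrix_mult V E x) \<subseteq> supp (rank_matrix_mult V E g)"
    and edges: "{u, v} \<in> E" "{v, w} \<in> E" and "u \<noteq> w"
    and alt: "g {u, v} = - g {v, w}" and chord: "g {u, w} = 0"
  shows "x {u, v} = - x {v, w}"
proof -
  have "{u, v, w} \<subseteq> V" "card {u, v} = 2" "card {v, w} = 2"
    using G edges by (auto simp: finite_simple_graph_def)
  then have uvw: "{u, v, w} \<subseteq> V" "distinct [u, v, w]"
    using \<open>u \<noteq> w\<close> by (auto simp: card_insert_if split: if_splits)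
  have "rank_matrix_mult V E g {u, v, w} = 0"
    using rank_matrix_mult_triple[OF G g uvw] alt chord by simp
  then have "rank_matrix_mult V E x {u, v, w} = 0"
    using sub by (auto simp: supp_def)
  moreover have "x {u, w} = 0"
    using vanishes_off_supp[OF G x sub chord] .
  ultimately show ?thesis
    using rank_matrix_mult_triple[OF G x uvw] by simp
qed

lemma alternating_proportional:
  fixes g x :: "'b \<Rightarrow> real"
  assumes "successively (\<lambda>e f. g e = - g f) L" and "successively (\<lambda>e f. x e = - x f) L"
    and "\<forall>e\<in>set L. g e \<noteq> 0"
  shows "\<exists>c. \<forall>e\<in>set L. x e = c * g e"
  using assms
proof (induction L rule: induct_list012)
  case (2 e)
  then have "x e = x e / g e * g e" by simp
  then show ?case by (intro exI[of _ "x e / g e"]) simp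
next
  case (3 e f L)
  then obtain c where c: "\<forall>e\<in>set (f # L). x e = c * g e" by auto
  with 3 have "x e = c * g e" by simp
  with c show ?case by auto
qed simp

lemma length_path_edges [simp]: "length (path_edges p) = length p - 1"
  by (simp add: path_edges_def)

lemma nth_path_edges: "Suc i < length p \<Longrightarrow> path_edges p ! i = {p ! i, p ! Suc i}"
  by (simp add: path_edges_def nth_tl)

lemma in_path_edgesE:
  assumes "e \<in> set (path_edges p)"
  obtains j where "Suc j < length p" and "e = {p ! j, p ! Suc j}"
proof -
  from assms obtain j where "j < length p - 1" "path_edges p ! j = e"
    by (auto simp: in_set_conv_nth)
  then show thesis
    by (intro that[of j]) (auto simp: nth_path_edges)
qed

text \<open>
  This property, common to paths and to cycles of length at least four, makes a vector supported on
  the walk vanish on the chord of two consecutive edges. The closed walk around a triangle violates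
  it.
\<close>

definition walk_chordless2 :: "'a list \<Rightarrow> bool" where
  "walk_chordless2 p \<longleftrightarrow> (\<forall>i. i + 2 < length p \<longrightarrow>
     p ! i \<noteq> p ! (i + 2) \<and> {p ! i, p ! (i + 2)} \<notin> set (path_edges p))"

lemma walk_chordless2_path:
  assumes "distinct p"
  shows "walk_chordless2 p"
  unfolding walk_chordless2_def
proof (intro allI impI conjI notI)
  fix i assume i: "i + 2 < length p"
  show False if "p ! i = p ! (i + 2)"
    using that i assms by (simp add: nth_eq_iff_index_eq)
  assume "{p ! i, p ! (i + 2)} \<in> set (path_edges p)"
  then obtain j where "Suc j < length p" "{p ! i, p ! (i + 2)} = {p ! j, p ! Suc j}"
    by (rule in_path_edgesE)
  then show False
    using i assms by (auto simp: doubleton_eq_iff nth_eq_iff_index_eq)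
qed

lemma walk_chordless2_cycle:
  assumes "distinct c" and "4 \<le> length c"
  shows "walk_chordless2 (c @ [hd c])"
  unfolding walk_chordless2_def
proof (intro allI impI conjI notI)
  let ?p = "c @ [hd c]"
  \<comment> \<open>Position \<open>length c\<close> of the closed walk is identified with position \<open>0\<close>.\<close>
  let ?r = "\<lambda>i. if i = length c then 0 else i"
  have "c \<noteq> []" using assms(2) by auto
  then have nth: "?p ! i = c ! ?r i" if "i < length ?p" for i
    using that by (cases "i = length c") (auto simp: nth_append hd_conv_nth)
  have eq_iff: "?p ! i = ?p ! j \<longleftrightarrow> ?r i = ?r j" if "i < length ?p" "j < length ?p" for i j
  proof -
    have "?r i < length c" "?r j < length c"
      using that assms(2) by auto
    then show ?thesis
      unfolding nth[OF that(1)] nth[OF that(2)] using assms(1) by (simp add: nth_eq_iff_index_eq)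
  qed
  fix i assume i: "i + 2 < length ?p"
  show False if "?p ! i = ?p ! (i + 2)"
    using that i assms(2) eq_iff[of i "i + 2"] by (auto split: if_splits)
  assume "{?p ! i, ?p ! (i + 2)} \<in> set (path_edges ?p)"
  then obtain j where j: "Suc j < length ?p"
    and same: "{?p ! i, ?p ! (i + 2)} = {?p ! j, ?p ! Suc j}"
    by (rule in_path_edgesE)
  have "i < length ?p" "j < length ?p"
    using i j by auto
  with same i j have
    "?r i = ?r j \<and> ?r (i + 2) = ?r (Suc j) \<or> ?r i = ?r (Suc j) \<and> ?r (i + 2) = ?r j"
    by (simp only: doubleton_eq_iff eq_iff)
  moreover have "?r i = i" "?r j = j"
    using i j by auto
  \<comment> \<open>For \<open>i + 2 = length c\<close> and \<open>j = 0\<close> this would mean \<open>length c - 2 = 1\<close>, the triangle.\<close>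
  ultimately show False
    using assms(2)
    by (cases "i + 2 = length c"; cases "Suc j = length c";
        simp only: if_True if_False simp_thms; arith)
qed

text \<open>
  Here paths and cycles are treated alike: the walk \<open>p\<close> may be open or closed, because the values of
  \<open>x\<close> are compared along consecutive entries of its edge list.
\<close>

lemma rank_circuit_if_alternating_walk:
  assumes G: "finite_simple_graph V E" and g: "g \<in> edge_space E"
    and "g \<noteq> (\<lambda>_. 0)" and "coprime_integral E g"
    and supp: "supp g = set (path_edges p)" and alt: "alternating_path g p"
    and chordless: "walk_chordless2 p"
  shows "rank_circuit V E g"
proof (rule rank_circuitI)
  fix x assume x: "x \<in> edge_space E"
    and sub: "supp (rank_matrix_mult V E x) \<subseteq> supp (rank_matrix_mult V E g)"
  have edge: "path_edges p ! i \<in> E" if "i < length p - 1" for i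
  proof -
    have "path_edges p ! i \<in> supp g"
      using that supp by simp
    then show ?thesis
      using g by (auto simp: supp_def edge_space_def)
  qed
  have "successively (\<lambda>e f. x e = - x f) (path_edges p)"
    unfolding successively_conv_nth
  proof (intro allI impI)
    fix i assume "Suc i < length (path_edges p)"
    then have i: "i + 2 < length p" by simp
    note nths = nth_path_edges[of i p] nth_path_edges[of "Suc i" p]
    have "g {p ! i, p ! (i + 2)} = 0" "p ! i \<noteq> p ! (i + 2)"
      using chordless i supp by (auto simp: walk_chordless2_def supp_def)
    moreover have "g (path_edges p ! i) = - g (path_edges p ! Suc i)"
      using alt i by (auto simp: alternating_path_def successively_conv_nth)
    ultimately show "x (path_edges p ! i) = - x (path_edges p ! Suc i)"
      using alternates_without_chord[OF G g x sub, of "p ! i" "p ! Suc i" "p ! (i + 2)"]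
        edge[of i] edge[of "Suc i"] nths i
      by simp
  qed
  moreover have "\<forall>e\<in>set (path_edges p). g e \<noteq> 0"
    using supp by (auto simp: supp_def)
  ultimately obtain c where "\<forall>e\<in>set (path_edges p). x e = c * g e"
    using alternating_proportional alt unfolding alternating_path_def by blast
  then have "x e = c * g e" for e
    using vanishes_off_supp[OF G x sub, of e] supp by (cases "g e = 0") (auto simp: supp_def)
  then show "\<exists>c. \<forall>e. x e = c * g e" by blast
qed (use assms in auto)

theorem lemma4p5:
  fixes V :: "'a set" and E :: "'a set set" and g :: "'a set \<Rightarrow> real"
  assumes "finite_simple_graph V E"
    and "g \<in> edge_space E"
    and "\<forall>e\<in>E. g e \<in> {0, 1, -1}"
    and "mixed_sign g"
    and "(\<exists>p. is_path V E p \<and> supp g = set (path_edges p) \<and> alternating_path g p) \<or>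
         (\<exists>c. is_cycle V E c \<and> even (length c) \<and> length c \<ge> 4 \<and>
              supp g = set (cycle_edges c) \<and> alternating_cycle g c)"
  shows "rank_circuit V E g"
proof -
  obtain e where "g e > 0"
    using assms(4) by (auto simp: mixed_sign_def)
  then have "e \<in> E"
    using assms(2) by (force simp: edge_space_def)
  with \<open>g e > 0\<close> assms(3) have e: "g e = 1" by force
  have nonzero: "g \<noteq> (\<lambda>_. 0)"
    using e by auto
  have coprime: "coprime_integral E g"
    using assms(3) \<open>e \<in> E\<close> e by (intro coprime_integral_if_one[of _ _ e]) auto
  note walk = rank_circuit_if_alternating_walk[OF assms(1,2) nonzero coprime]
  from assms(5) show ?thesis
  proof (elim disjE exE conjE)
    fix p assume "is_path V E p" "supp g = set (path_edges p)" "alternating_path g p"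
    then show ?thesis
      by (intro walk walk_chordless2_path) (auto simp: is_path_def)
  next
    fix c assume "is_cycle V E c" "4 \<le> length c" "supp g = set (cycle_edges c)"
      and "alternating_cycle g c"
    moreover from this have "alternating_path g (c @ [hd c])"
      by (simp add: alternating_cycle_def alternating_path_def cycle_edges_def
          successively_append_iff)
    ultimately show ?thesis
      by (intro walk[of "c @ [hd c]"] walk_chordless2_cycle)
        (auto simp: is_cycle_def cycle_edges_def)
  qed
qed

end
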